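(* Let $M_{3/4}$ be the additive submonoid of $\mathbb{Q}$ generated by $\{(3/4)^n : n \in \mathbb{N}_0\}$. Then the monoid algebra $\mathbb{Q}[M_{3/4}]$ satisfies the almost ACCP but does not satisfy the ACCP.
   Context: A monoid is a cancellative commutative semigroup with identity. For an additive submonoid $M$ of $\mathbb{Q}_{\ge 0}$ and a field $F$, the monoid algebra $F[M]$ is the integral domain of polynomial expressions $\sum_{i=1}^k c_i x^{m_i}$ with $c_i \in F$, $m_i \in M$. An element $a$ of a monoid $H$ is an atom if it is not a unit and $a = bc$ implies $b$ or $c$ is a unit; an element is atomic if it is a unit or a finite product of atoms. An element $b$ of $H$ satisfies the ACCP if every ascending chain of principal ideals $b H \subseteq b_1 H \subseteq b_2 H \subseteq \cdots$ starting at $bH$ stabilizes; $H$ satisfies the ACCP if every element does. $H$ satisfies the almost ACCP if for every finite nonempty subset $S \subseteq H$ there exist an atomic common divisor $d$ of $S$ in $H$ and some $s \in S$ such that $s/d$ satisfies the ACCP. An integral domain $R$ satisfies the ACCP (resp. almost ACCP) if its multiplicative monoid $R \setminus \{0\}$ does. *)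

theory Defs
  imports Complex_Main "HOL-Library.Poly_Mapping"
begin

inductive_set M34 :: "rat set" where
  zero: "0 \<in> M34"
| gen: "(3/4) ^ n \<in> M34"
| add: "a \<in> M34 \<Longrightarrow> b \<in> M34 \<Longrightarrow> a + b \<in> M34"

text \<open>Monoid algebra F[M] for an additive submonoid M: finitely supported
  functions M -> F (coefficients), with convolution product; the element
  Poly_Mapping.single m c plays the role of c x^m.\<close>
definition monoid_algebra :: "'m::monoid_add set \<Rightarrow> ('m \<Rightarrow>\<^sub>0 'f::comm_ring_1) set" where
  "monoid_algebra M = {p. Poly_Mapping.keys p \<subseteq> M}"

definition nonzero_elems :: "'a::zero set \<Rightarrow> 'a set" where
  "nonzero_elems R = R - {0}"

definition dvd_in :: "'a::comm_monoid_mult set \<Rightarrow> 'a \<Rightarrow> 'a \<Rightarrow> bool" where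
  "dvd_in H a b \<longleftrightarrow> (\<exists>c\<in>H. b = a * c)"

definition unit_in :: "'a::comm_monoid_mult set \<Rightarrow> 'a \<Rightarrow> bool" where
  "unit_in H u \<longleftrightarrow> u \<in> H \<and> (\<exists>v\<in>H. u * v = 1)"

definition atom_in :: "'a::comm_monoid_mult set \<Rightarrow> 'a \<Rightarrow> bool" where
  "atom_in H a \<longleftrightarrow> a \<in> H \<and> \<not> unit_in H a \<and>
     (\<forall>b\<in>H. \<forall>c\<in>H. a = b * c \<longrightarrow> unit_in H b \<or> unit_in H c)"

definition atomic_in :: "'a::comm_monoid_mult set \<Rightarrow> 'a \<Rightarrow> bool" where
  "atomic_in H a \<longleftrightarrow> a \<in> H \<and>
     (unit_in H a \<or> (\<exists>xs. xs \<noteq> [] \<and> (\<forall>x\<in>set xs. atom_in H x) \<and> a = prod_list xs))"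

text \<open>b satisfies the ACCP: every ascending chain of principal ideals
  bH \<subseteq> b_1 H \<subseteq> b_2 H \<subseteq> ... stabilizes.\<close>
definition accp_elem :: "'a::comm_monoid_mult set \<Rightarrow> 'a \<Rightarrow> bool" where
  "accp_elem H b \<longleftrightarrow> b \<in> H \<and>
     (\<forall>f :: nat \<Rightarrow> 'a. f 0 = b \<longrightarrow> (\<forall>n. f n \<in> H \<and> dvd_in H (f (Suc n)) (f n)) \<longrightarrow>
        (\<exists>N. \<forall>n\<ge>N. dvd_in H (f n) (f (Suc n))))"

definition accp :: "'a::comm_monoid_mult set \<Rightarrow> bool" where
  "accp H \<longleftrightarrow> (\<forall>b\<in>H. accp_elem H b)"

definition almost_accp :: "'a::comm_monoid_mult set \<Rightarrow> bool" where
  "almost_accp H \<longleftrightarrow> (\<forall>S. finite S \<and> S \<noteq> {} \<and> S \<subseteq> H \<longrightarrow>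
     (\<exists>d. atomic_in H d \<and> (\<forall>s\<in>S. dvd_in H d s) \<and>
          (\<exists>s\<in>S. \<exists>q\<in>H. s = d * q \<and> accp_elem H q)))"

end

theory Submission
  imports
    Defs
    "HOL-Analysis.Complex_Transcendental"
    "HOL-Computational_Algebra.Fundamental_Theorem_Algebra"
    "HOL-Number_Theory.Cong"
begin

text \<open>
  A sum of powers \<open>(3/4)^n\<close> with all multiplicities at most \<open>2\<close> is rigid: comparing residues modulo
  \<open>3\<close> shows that it has no other expression as such a sum. Carrying with
  \<open>3 (3/4)^n = 4 (3/4)^(n+1)\<close> moves all multiplicities exceeding \<open>2\<close> to one common power \<open>(3/4)^N\<close>, and
  subtracting the least of them shows that every finite set of exponents has a common divisor \<open>d\<close>
  whose quotients include a rigid one. Since \<open>x^d\<close> is a product of atoms \<open>x^((3/4)^n)\<close>, it suffices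
  that an \<open>f\<close> with a rigid exponent satisfies the ACCP, and for this that the degrees of its
  nonunit divisors \<open>g\<close> are bounded away from \<open>0\<close>. If \<open>g\<close> has no constant term, a nonzero exponent of
  \<open>g\<close> divides the rigid one, which bounds it below. If \<open>g\<close> has a constant term but all its exponents
  are below \<open>(3/4)^n\<close>, then \<open>g\<close> is a polynomial in \<open>x^(3^n/4^K)\<close>, so its complex zeros are
  permuted by the \<open>3^n\<close>-th roots of unity. As \<open>3\<close> and \<open>4\<close> are coprime, this produces \<open>3^n\<close> distinct zeros
  of \<open>f\<close>, viewed as a polynomial in \<open>x^(1/4^N)\<close> for a fixed \<open>N\<close>, which is impossible for large \<open>n\<close>.

  The ACCP fails along the chain generated by the elements \<open>x^(3 (3/4)^n)\<close>.
\<close>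

section \<open>Finitely supported functions as exponential polynomials\<close>

lemma poly_mapping_eq_sum_single:
  fixes p :: "'a \<Rightarrow>\<^sub>0 'b::comm_monoid_add"
  shows "p = (\<Sum>k\<in>Poly_Mapping.keys p. Poly_Mapping.single k (Poly_Mapping.lookup p k))"
  by (rule poly_mapping_eqI)
     (auto simp: lookup_sum lookup_single when_def sum.delta' in_keys_iff)

lemma mult_eq_sum_single:
  fixes p q :: "'a::monoid_add \<Rightarrow>\<^sub>0 'b::semiring_1"
  shows "p * q = (\<Sum>i\<in>Poly_Mapping.keys p. \<Sum>j\<in>Poly_Mapping.keys q.
            Poly_Mapping.single (i + j) (Poly_Mapping.lookup p i * Poly_Mapping.lookup q j))"
proof -
  have "p * q = (\<Sum>i\<in>Poly_Mapping.keys p. Poly_Mapping.single i (Poly_Mapping.lookup p i))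
      * (\<Sum>j\<in>Poly_Mapping.keys q. Poly_Mapping.single j (Poly_Mapping.lookup q j))"
    using poly_mapping_eq_sum_single[of p] poly_mapping_eq_sum_single[of q] by simp
  then show ?thesis by (simp add: sum_product mult_single)
qed

text \<open>When only one pair of exponents has the sum \<open>a + b\<close>, nothing can cancel its
  contribution. This is meant for extreme exponents.\<close>

lemma lookup_mult_unique:
  fixes p q :: "'a::monoid_add \<Rightarrow>\<^sub>0 'b::semiring_1"
  assumes "a \<in> Poly_Mapping.keys p" "b \<in> Poly_Mapping.keys q"
    and u: "\<And>i j. i \<in> Poly_Mapping.keys p \<Longrightarrow> j \<in> Poly_Mapping.keys q \<Longrightarrow> i + j = a + b \<Longrightarrow> i = a \<and> j = b"
  shows "Poly_Mapping.lookup (p * q) (a + b) = Poly_Mapping.lookup p a * Poly_Mapping.lookup q b"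
proof -
  have "Poly_Mapping.lookup (p * q) (a + b)
      = (\<Sum>i\<in>Poly_Mapping.keys p. \<Sum>j\<in>Poly_Mapping.keys q.
          if i = a then (if j = b then Poly_Mapping.lookup p a * Poly_Mapping.lookup q b else 0) else 0)"
    unfolding mult_eq_sum_single lookup_sum lookup_single when_def
    by (intro sum.cong refl) (use u in auto)
  also have "\<dots> = Poly_Mapping.lookup p a * Poly_Mapping.lookup q b"
    using assms(1,2) by (subst sum.swap) simp
  finally show ?thesis .
qed

section \<open>Extreme exponents and degrees of products\<close>

abbreviation deg :: "('a::linorder \<Rightarrow>\<^sub>0 'b::zero) \<Rightarrow> 'a" where
  "deg p \<equiv> Max (Poly_Mapping.keys p)"

lemma deg_in_keys: "p \<noteq> 0 \<Longrightarrow> deg p \<in> Poly_Mapping.keys p"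
  by simp

lemma Max_plus_Max_in_keys_mult:
  fixes p q :: "'a::linordered_ab_group_add \<Rightarrow>\<^sub>0 'b::idom"
  assumes "p \<noteq> 0" "q \<noteq> 0"
  shows "deg p + deg q \<in> Poly_Mapping.keys (p * q)"
proof -
  have "i = deg p \<and> j = deg q"
    if "i \<in> Poly_Mapping.keys p" "j \<in> Poly_Mapping.keys q" "i + j = deg p + deg q" for i j
    using that Max_ge[OF finite_keys that(1)] Max_ge[OF finite_keys that(2)]
    by (metis add_le_less_mono add_less_le_mono antisym_conv1 order_less_irrefl)
  then have "Poly_Mapping.lookup (p * q) (deg p + deg q)
      = Poly_Mapping.lookup p (deg p) * Poly_Mapping.lookup q (deg q)"
    by (intro lookup_mult_unique) (use assms in auto)
  moreover have "Poly_Mapping.lookup p (deg p) \<noteq> 0" "Poly_Mapping.lookup q (deg q) \<noteq> 0"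
    using assms deg_in_keys by (auto simp flip: in_keys_iff)
  ultimately show ?thesis
    by (simp add: in_keys_iff)
qed

lemma Min_plus_Min_in_keys_mult:
  fixes p q :: "'a::linordered_ab_group_add \<Rightarrow>\<^sub>0 'b::idom"
  assumes "p \<noteq> 0" "q \<noteq> 0"
  shows "Min (Poly_Mapping.keys p) + Min (Poly_Mapping.keys q) \<in> Poly_Mapping.keys (p * q)"
    (is "?a + ?b \<in> _")
proof -
  have m: "?a \<in> Poly_Mapping.keys p" "?b \<in> Poly_Mapping.keys q"
    using assms by auto
  have "i = ?a \<and> j = ?b"
    if "i \<in> Poly_Mapping.keys p" "j \<in> Poly_Mapping.keys q" "i + j = ?a + ?b" for i j
    using that Min_le[OF finite_keys that(1)] Min_le[OF finite_keys that(2)]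
    by (metis add_le_less_mono add_less_le_mono antisym_conv1 order_less_irrefl)
  then have "Poly_Mapping.lookup (p * q) (?a + ?b)
      = Poly_Mapping.lookup p ?a * Poly_Mapping.lookup q ?b"
    by (intro lookup_mult_unique m)
  then show ?thesis
    using m by (simp add: in_keys_iff)
qed

lemma deg_mult:
  fixes p q :: "'a::linordered_ab_group_add \<Rightarrow>\<^sub>0 'b::idom"
  assumes "p \<noteq> 0" "q \<noteq> 0"
  shows "deg (p * q) = deg p + deg q"
proof (rule Max_eqI)
  fix y assume "y \<in> Poly_Mapping.keys (p * q)"
  then obtain a b where "y = a + b" "a \<in> Poly_Mapping.keys p" "b \<in> Poly_Mapping.keys q"
    using keys_mult[of p q] by blast
  then show "y \<le> deg p + deg q"
    by (simp add: add_mono)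
qed (use Max_plus_Max_in_keys_mult[OF assms] in auto)

text \<open>Substituting \<open>exp w\<close> for the variable makes every rational exponent meaningful, so that a
  single family of ring homomorphisms serves all the polynomial subrings.\<close>

definition exp_eval :: "complex \<Rightarrow> (rat \<Rightarrow>\<^sub>0 rat) \<Rightarrow> complex" where
  "exp_eval w p = (\<Sum>k\<in>Poly_Mapping.keys p. of_rat (Poly_Mapping.lookup p k) * exp (of_rat k * w))"

lemma exp_eval_superset:
  assumes "finite A" "Poly_Mapping.keys p \<subseteq> A"
  shows "exp_eval w p = (\<Sum>k\<in>A. of_rat (Poly_Mapping.lookup p k) * exp (of_rat k * w))"
  unfolding exp_eval_def using assms
  by (intro sum.mono_neutral_left) (auto simp: in_keys_iff)

lemma exp_eval_add: "exp_eval w (p + q) = exp_eval w p + exp_eval w q"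
proof -
  let ?A = "Poly_Mapping.keys p \<union> Poly_Mapping.keys q"
  have "Poly_Mapping.keys (p + q) \<subseteq> ?A"
    by (rule Poly_Mapping.keys_add)
  then show ?thesis
    by (simp add: exp_eval_superset[of ?A] lookup_add of_rat_add distrib_right sum.distrib)
qed

lemma exp_eval_sum: "exp_eval w (\<Sum>i\<in>A. f i) = (\<Sum>i\<in>A. exp_eval w (f i))"
  by (induction A rule: infinite_finite_induct) (auto simp: exp_eval_add, auto simp: exp_eval_def)

lemma exp_eval_single: "exp_eval w (Poly_Mapping.single k c) = of_rat c * exp (of_rat k * w)"
  by (simp add: exp_eval_def)

lemma exp_eval_mult: "exp_eval w (p * q) = exp_eval w p * exp_eval w q"
  unfolding mult_eq_sum_single exp_eval_sum exp_eval_single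
  by (simp add: exp_eval_def sum_product of_rat_mult of_rat_add distrib_right distrib_left exp_add mult_ac)

text \<open>If the exponents of \<open>p\<close> are natural multiples of \<open>d > 0\<close>, then \<open>p\<close> is the polynomial
  \<open>scaled_poly d p\<close> in the \<open>d\<close>-th power of the variable.\<close>

definition scaled_poly :: "rat \<Rightarrow> (rat \<Rightarrow>\<^sub>0 rat) \<Rightarrow> complex poly" where
  "scaled_poly d p = (\<Sum>k\<in>Poly_Mapping.keys p. monom (of_rat (Poly_Mapping.lookup p k)) (nat \<lfloor>k / d\<rfloor>))"

lemma poly_scaled_poly:
  assumes "d > 0" "Poly_Mapping.keys p \<subseteq> range (\<lambda>n. d * of_nat n)"
  shows "poly (scaled_poly d p) (exp (of_rat d * w)) = exp_eval w p"
  unfolding scaled_poly_def exp_eval_def poly_sum poly_monom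
proof (intro sum.cong refl arg_cong2[where f = "(*)"])
  fix k assume "k \<in> Poly_Mapping.keys p"
  then obtain n where k: "k = d * of_nat n" using assms(2) by auto
  then have "nat \<lfloor>k / d\<rfloor> = n" using assms(1) by simp
  then show "exp (of_rat d * w) ^ nat \<lfloor>k / d\<rfloor> = exp (of_rat k * w)"
    by (simp add: k of_rat_mult mult_ac flip: exp_of_nat_mult)
qed

lemma coeff_scaled_poly:
  assumes "d > 0" "Poly_Mapping.keys p \<subseteq> range (\<lambda>n. d * of_nat n)"
  shows "coeff (scaled_poly d p) n = of_rat (Poly_Mapping.lookup p (d * of_nat n))"
proof -
  have "coeff (scaled_poly d p) n
     = (\<Sum>k\<in>Poly_Mapping.keys p. if k = d * of_nat n then of_rat (Poly_Mapping.lookup p k) else 0)"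
    unfolding scaled_poly_def coeff_sum coeff_monom
  proof (intro sum.cong refl)
    fix k assume "k \<in> Poly_Mapping.keys p"
    then obtain n' where k: "k = d * of_nat n'" using assms(2) by auto
    then have "nat \<lfloor>k / d\<rfloor> = n'" using assms(1) by simp
    then show "(if nat \<lfloor>k / d\<rfloor> = n then of_rat (Poly_Mapping.lookup p k) else 0)
        = (if k = d * of_nat n then of_rat (Poly_Mapping.lookup p k) else (0::complex))"
      using k assms(1) by auto
  qed
  also have "\<dots> = of_rat (Poly_Mapping.lookup p (d * of_nat n))"
    by (auto simp: in_keys_iff)
  finally show ?thesis .
qed

section \<open>The monoid\<close>

text \<open>Values of \<open>c\<close> from \<open>N\<close> on are ignored, so coefficient
  functions carry no support condition.\<close>

definition rep :: "nat \<Rightarrow> (nat \<Rightarrow> nat) \<Rightarrow> rat" where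
  "rep N c = (\<Sum>n<N. of_nat (c n) * (3/4) ^ n)"

lemma rep_0 [simp]: "rep 0 c = 0"
  by (simp add: rep_def)

lemma rep_Suc: "rep (Suc N) c = rep N c + of_nat (c N) * (3/4) ^ N"
  by (simp add: rep_def)

lemma rep_Suc_shift: "rep (Suc N) c = of_nat (c 0) + 3/4 * rep N (\<lambda>n. c (Suc n))"
  unfolding rep_def sum.lessThan_Suc_shift by (simp add: sum_distrib_left mult_ac)

lemma rep_add: "rep N (\<lambda>n. c n + c' n) = rep N c + rep N c'"
  by (simp add: rep_def sum.distrib distrib_right)

lemma rep_extend:
  assumes "\<forall>n\<ge>K. c n = 0" "K \<le> N"
  shows "rep N c = rep K c"
  unfolding rep_def using assms by (intro sum.mono_neutral_right) auto

lemma M34_nonneg: "a \<in> M34 \<Longrightarrow> 0 \<le> a"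
  by (induction rule: M34.induct) auto

lemma M34_of_nat_mult: "a \<in> M34 \<Longrightarrow> of_nat n * a \<in> M34"
  by (induction n) (auto simp: distrib_right intro: M34.intros)

lemma M34_rep: "rep N c \<in> M34"
  by (induction N) (auto simp: rep_Suc intro!: M34.intros M34_of_nat_mult)

lemma rep_indicator:
  assumes "n < N"
  shows "rep N (\<lambda>k. if k = n then 1 else 0) = (3/4) ^ n"
proof -
  have "rep N (\<lambda>k. if k = n then 1 else 0) = (\<Sum>k<N. if k = n then (3/4) ^ n else 0)"
    unfolding rep_def by (intro sum.cong) auto
  then show ?thesis using assms by simp
qed

text \<open>One \<open>c\<close> works for all large \<open>N\<close>, so that representations of
  several elements can be brought to a common length.\<close>

lemma M34_imp_rep:
  assumes "a \<in> M34"
  shows "\<exists>c K. (\<forall>N\<ge>K. a = rep N c)"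
  using assms
proof (induction rule: M34.induct)
  case zero
  have "0 = rep N (\<lambda>_. 0)" for N by (simp add: rep_def)
  then show ?case by blast
next
  case (gen n)
  have "\<forall>N\<ge>Suc n. (3/4) ^ n = rep N (\<lambda>k. if k = n then 1 else 0)"
    by (simp add: rep_indicator Suc_le_eq)
  then show ?case by blast
next
  case (add a b)
  then obtain c K c' K' where "\<forall>N\<ge>K. a = rep N c" "\<forall>N\<ge>K'. b = rep N c'" by blast
  then have "\<forall>N\<ge>max K K'. a + b = rep N (\<lambda>n. c n + c' n)"
    by (metis rep_add max.bounded_iff)
  then show ?case by blast
qed

section \<open>Rigidity by residues modulo 3\<close>

lemma rep_denominator: "\<exists>z::nat. 4 ^ N * rep N c = of_nat z"
proof (induction N arbitrary: c)
  case 0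
  then show ?case by (auto intro: exI[of _ 0])
next
  case (Suc N)
  obtain z :: nat where "4 ^ N * rep N (\<lambda>n. c (Suc n)) = of_nat z" using Suc by blast
  then have "4 ^ Suc N * rep (Suc N) c = of_nat (4 ^ Suc N * c 0 + 3 * z)"
    by (simp add: rep_Suc_shift algebra_simps)
  then show ?case by blast
qed

text \<open>Modulo \<open>3\<close> the equation leaves \<open>c' 0 = c 0 + 3 * i\<close>, and this
  surplus passes to the next power as \<open>4 * i\<close>. Induction then bounds
  \<open>4 * i\<close> by the next coefficient of \<open>c\<close>, which is at most
  \<open>2\<close>, so \<open>i = 0\<close>. The function \<open>c'\<close> stays arbitrary because
  the induction hypothesis is applied with the surplus added to it.\<close>

lemma rep_unique:
  assumes "\<forall>n. c n \<le> 2" "rep N c = rep N c'" "n < N"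
  shows "c n = c' n"
  using assms
proof (induction N arbitrary: c c' n)
  case 0
  then show ?case by simp
next
  case (Suc N)
  let ?d = "\<lambda>n. c (Suc n)" and ?d' = "\<lambda>n. c' (Suc n)"
  have eq: "of_nat (c 0) + 3/4 * rep N ?d = of_nat (c' 0) + 3/4 * rep N ?d'"
    using Suc.prems(2) by (simp add: rep_Suc_shift)
  obtain z z' :: nat where z: "4 ^ N * rep N ?d = of_nat z" "4 ^ N * rep N ?d' = of_nat z'"
    using rep_denominator by meson
  have "rat_of_nat (4 ^ Suc N * c 0 + 3 * z) = 4 ^ Suc N * (of_nat (c 0) + 3/4 * rep N ?d)"
    using z by (simp add: algebra_simps)
  also have "\<dots> = rat_of_nat (4 ^ Suc N * c' 0 + 3 * z')"
    unfolding eq using z by (simp add: algebra_simps)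
  finally have "4 ^ Suc N * c 0 + 3 * z = 4 ^ Suc N * c' 0 + 3 * z'"
    using of_nat_eq_iff by blast
  then have "(4 ^ Suc N * c 0 + 3 * z) mod 3 = (4 ^ Suc N * c' 0 + 3 * z') mod 3"
    by simp
  moreover have "(4 ^ k * a + 3 * y) mod 3 = a mod 3" for k a y :: nat
  proof -
    have "(4 ^ k * a) mod 3 = ((4 mod 3) ^ k mod 3 * a) mod 3"
      by (metis mod_mult_left_eq power_mod)
    then show ?thesis by simp
  qed
  ultimately have "c 0 mod 3 = c' 0 mod 3"
    by metis
  moreover have "c 0 \<le> 2" using Suc.prems(1) by simp
  ultimately have "c 0 = c' 0 mod 3" by simp
  then obtain i where i: "c' 0 = c 0 + 3 * i"
    by (metis mod_mult_div_eq)
  have r: "rep N ?d = of_nat (4 * i) + rep N ?d'"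
    using eq i by (simp add: algebra_simps)
  show ?case
  proof (cases N)
    case 0
    then show ?thesis using r i Suc.prems(3) by auto
  next
    case (Suc N')
    let ?e = "\<lambda>n. if n = 0 then 4 * i + ?d' 0 else ?d' n"
    have "rep N ?e = of_nat (4 * i) + rep N ?d'"
      unfolding Suc rep_Suc_shift by (simp add: algebra_simps)
    then have *: "?d k = ?e k" if "k < N" for k
      using Suc.IH[of ?d ?e k] r that Suc.prems(1) by simp
    have "4 * i \<le> ?d 0" using *[of 0] Suc by simp
    moreover have "?d 0 \<le> 2" using Suc.prems(1) by blast
    ultimately have "i = 0" by linarith
    then show ?thesis
      using * i Suc.prems(3) by (cases n) (auto split: if_splits)
  qed
qed

text \<open>Representations of \<open>a\<close> and \<open>b\<close> add up to one of the rigid sum,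
  so by uniqueness \<open>a\<close> uses only powers with index below \<open>N\<close>, and it uses
  at least one.\<close>

lemma rep_divisor_ge:
  assumes c: "\<forall>n. c n \<le> 2" and "a \<in> M34" "b \<in> M34" "a + b = rep N c" "a \<noteq> 0"
  shows "(3/4) ^ N \<le> a"
proof -
  obtain ca Ka cb Kb where ca: "\<forall>K\<ge>Ka. a = rep K ca" and cb: "\<forall>K\<ge>Kb. b = rep K cb"
    using M34_imp_rep[OF assms(2)] M34_imp_rep[OF assms(3)] by blast
  define K where "K = max N (max Ka Kb)"
  \<comment> \<open>\<open>c\<close> may be nonzero from \<open>N\<close> on, so it is cut off
    before the length grows to \<open>K\<close>.\<close>
  define e where "e n = (if n < N then c n else 0)" for n
  have a: "a = rep K ca" and b: "b = rep K cb"
    by (rule ca[rule_format] cb[rule_format], simp add: K_def)+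
  have "rep K e = rep N e"
    by (rule rep_extend) (auto simp: K_def e_def)
  also have "\<dots> = rep N c"
    unfolding rep_def by (intro sum.cong) (auto simp: e_def)
  also have "\<dots> = rep K (\<lambda>n. ca n + cb n)"
    unfolding rep_add assms(4)[symmetric] by (rule arg_cong2[OF a b, where f = "(+)"])
  finally have eq: "rep K e = rep K (\<lambda>n. ca n + cb n)" .
  have "\<forall>n. e n \<le> 2"
    using c by (simp add: e_def)
  have zero: "ca n = 0" if "N \<le> n" "n < K" for n
    using rep_unique[OF \<open>\<forall>n. e n \<le> 2\<close> eq that(2)] that(1) by (simp add: e_def)
  have "\<exists>n<K. ca n \<noteq> 0"
  proof (rule ccontr)
    assume "\<not> ?thesis"
    then have "rep K ca = 0" by (simp add: rep_def)
    then show False using a \<open>a \<noteq> 0\<close> by simp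
  qed
  then obtain n where n: "n < K" "ca n \<noteq> 0" by blast
  then have "n < N" using zero[of n] by linarith
  then have "(3/4) ^ N \<le> ((3/4) ^ n :: rat)"
    by (intro power_decreasing) auto
  also have "\<dots> \<le> rat_of_nat (ca n) * (3/4) ^ n"
    using n(2) by simp
  also have "\<dots> \<le> a"
    unfolding a rep_def using n by (intro member_le_sum) auto
  finally show ?thesis .
qed

section \<open>Carrying and common divisors\<close>

lemma rep_carry:
  "\<exists>c m. (\<forall>n. c n \<le> 2) \<and> rep N a + of_nat k * (3/4) ^ N = rep N c + of_nat m * (3/4) ^ N"
proof (induction N arbitrary: k)
  case 0
  show ?case by (rule exI[of _ "\<lambda>_. 0"]) auto
next
  case (Suc N)
  \<comment> \<open>The induction hypothesis is used with the coefficient \<open>a N\<close> in the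
    role of \<open>k\<close>.\<close>
  obtain c m where c: "\<forall>n. c n \<le> 2"
    and eq: "rep N a + of_nat (a N) * (3/4) ^ N = rep N c + of_nat m * (3/4) ^ N"
    using Suc by blast
  \<comment> \<open>Of the \<open>m\<close> copies of \<open>(3/4)^N\<close>, \<open>m mod 3\<close>
    stay, and each removed triple becomes four copies of \<open>(3/4)^(N+1)\<close>.\<close>
  have "m = 3 * (m div 3) + m mod 3" by simp
  then have m: "rat_of_nat m = 3 * of_nat (m div 3) + of_nat (m mod 3)"
    by (metis of_nat_add of_nat_mult of_nat_numeral)
  let ?c = "c(N := m mod 3)"
  have "rep N ?c = rep N c"
    by (simp add: rep_def)
  then have "rep (Suc N) a + of_nat k * (3/4) ^ Suc N
      = rep (Suc N) ?c + of_nat (4 * (m div 3) + k) * (3/4) ^ Suc N"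
    using eq by (simp add: rep_Suc m algebra_simps)
  moreover have "\<forall>n. ?c n \<le> 2"
    using c by auto
  ultimately show ?case by blast
qed

text \<open>All elements of \<open>T\<close> are carried to one length \<open>N\<close>. The
  smallest leftover multiple of \<open>(3/4)^N\<close> is \<open>d\<close>, and an element attaining
  it is \<open>t\<close>.\<close>

lemma finite_common_divisor:
  assumes "finite T" "T \<noteq> {}" "T \<subseteq> M34"
  obtains d t N c where "d \<in> M34" "\<And>s. s \<in> T \<Longrightarrow> s - d \<in> M34"
    "t \<in> T" "\<forall>n. c n \<le> 2" "t - d = rep N c"
proof -
  have "\<forall>\<^sub>F N in sequentially. \<exists>a. t = rep N a" if "t \<in> T" for t
    using M34_imp_rep[of t] that assms(3) unfolding eventually_sequentially by blast
  then have "\<forall>\<^sub>F N in sequentially. \<forall>t\<in>T. \<exists>a. t = rep N a"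
    using assms(1) by (intro eventually_ball_finite) auto
  then obtain N where N: "\<forall>t\<in>T. \<exists>a. t = rep N a"
    using eventually_happens'[OF sequentially_bot] by blast
  have "\<forall>t\<in>T. \<exists>c m. (\<forall>n. c n \<le> 2) \<and> t = rep N c + of_nat m * (3/4) ^ N"
  proof
    fix t assume "t \<in> T"
    then obtain a where "t = rep N a" using N by blast
    then show "\<exists>c m. (\<forall>n. c n \<le> 2) \<and> t = rep N c + of_nat m * (3/4) ^ N"
      using rep_carry[of N a 0] by simp
  qed
  then obtain c m where
    "\<forall>t\<in>T. (\<forall>n. c t n \<le> 2) \<and> t = rep N (c t) + of_nat (m t) * (3/4) ^ N"
    unfolding bchoice_iff by blast
  then have c: "\<And>t n. t \<in> T \<Longrightarrow> c t n \<le> 2"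
    and m: "\<And>t. t \<in> T \<Longrightarrow> t = rep N (c t) + of_nat (m t) * (3/4) ^ N"
    by blast+
  define t where "t = arg_min_on m T"
  have t: "t \<in> T" "\<And>s. s \<in> T \<Longrightarrow> m t \<le> m s"
    unfolding t_def by (simp_all add: arg_min_if_finite(1) arg_min_least assms(1,2))
  show thesis
  proof
    show "of_nat (m t) * (3/4) ^ N \<in> M34"
      by (intro M34_of_nat_mult M34.gen)
    show "s - of_nat (m t) * (3/4) ^ N \<in> M34" if "s \<in> T" for s
    proof -
      have "rat_of_nat (m s) = of_nat (m s - m t) + of_nat (m t)"
        using t(2)[OF that] by (simp flip: of_nat_add)
      then have "rat_of_nat (m s) * (3/4) ^ N = of_nat (m s - m t) * (3/4) ^ N + of_nat (m t) * (3/4) ^ N"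
        by (simp only: distrib_right)
      then have eq: "s - of_nat (m t) * (3/4) ^ N = rep N (c s) + of_nat (m s - m t) * (3/4) ^ N"
        using m[OF that] by linarith
      show ?thesis
        unfolding eq by (intro M34.add M34_rep M34_of_nat_mult M34.gen)
    qed
    show "t - of_nat (m t) * (3/4) ^ N = rep N (c t)"
      using m[OF t(1)] by linarith
  qed (use t(1) c in auto)
qed

text \<open>Elements are nonnegative, so the summands of a small element are small too; its
  generators \<open>(3/4)^k\<close> all have \<open>k \<ge> n\<close>, which supplies the factor
  \<open>3^n\<close>. The case \<open>n = 0\<close> just clears denominators. The eventual form lets
  finitely many elements share one \<open>K\<close>.\<close>

lemma M34_small_imp_multiple:
  assumes "a \<in> M34" "n = 0 \<or> a < (3/4) ^ n"
  shows "\<forall>\<^sub>F K in sequentially. a \<in> range (\<lambda>z::nat. 3 ^ n / 4 ^ K * of_nat z)"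
  using assms
proof (induction rule: M34.induct)
  case zero
  show ?case by (auto intro!: always_eventually range_eqI[of _ _ 0])
next
  case (gen k)
  have "n \<le> k"
  proof (rule ccontr)
    assume "\<not> n \<le> k"
    then have "(3/4) ^ n \<le> ((3/4) ^ k :: rat)"
      by (intro power_decreasing) auto
    with gen \<open>\<not> n \<le> k\<close> show False by auto
  qed
  have "(3/4) ^ k = 3 ^ n / 4 ^ K * rat_of_nat (3 ^ (k - n) * 4 ^ (K - k))" if "K \<ge> k" for K
  proof -
    have "(3::rat) ^ k = 3 ^ n * 3 ^ (k - n)" "(4::rat) ^ K = 4 ^ k * 4 ^ (K - k)"
      using \<open>n \<le> k\<close> that by (simp_all flip: power_add)
    then show ?thesis by (simp add: power_divide)
  qed
  then show ?case unfolding eventually_sequentially by blast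
next
  case (add a b)
  then have "\<forall>\<^sub>F K in sequentially. a \<in> range (\<lambda>z::nat. 3 ^ n / 4 ^ K * of_nat z)"
    "\<forall>\<^sub>F K in sequentially. b \<in> range (\<lambda>z::nat. 3 ^ n / 4 ^ K * of_nat z)"
    using M34_nonneg[of a] M34_nonneg[of b] by fastforce+
  then show ?case
  proof eventually_elim
    case (elim K)
    then obtain x y :: nat where "a = 3 ^ n / 4 ^ K * of_nat x" "b = 3 ^ n / 4 ^ K * of_nat y"
      by blast
    then have "a + b = 3 ^ n / 4 ^ K * of_nat (x + y)"
      by (simp add: distrib_left)
    then show ?case by blast
  qed
qed

lemma keys_M34_small_imp_multiples:
  assumes "Poly_Mapping.keys p \<subseteq> M34" "n = 0 \<or> (\<forall>k\<in>Poly_Mapping.keys p. k < (3/4) ^ n)"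
  shows "\<forall>\<^sub>F K in sequentially. Poly_Mapping.keys p \<subseteq> range (\<lambda>z::nat. 3 ^ n / 4 ^ K * of_nat z)"
  unfolding subset_eq
  by (intro eventually_ball_finite ballI M34_small_imp_multiple) (use assms in auto)

section \<open>Divisors with nonzero constant term\<close>

text \<open>A nonconstant \<open>g\<close> of this kind would force \<open>3^n\<close> zeros on the
  nonzero polynomial \<open>F\<close>, whose degree is \<open>n < 3^n\<close>. The bound
  \<open>n\<close> is read off from \<open>f\<close> alone, before any divisor is chosen.\<close>

lemma small_divisor_constant:
  fixes f :: "rat \<Rightarrow>\<^sub>0 rat"
  assumes "f \<noteq> 0" "Poly_Mapping.keys f \<subseteq> M34"
  obtains n where "\<And>g h. \<lbrakk>f = g * h; Poly_Mapping.keys g \<subseteq> M34; 0 \<in> Poly_Mapping.keys g; deg g < (3/4) ^ n\<rbrakk>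
     \<Longrightarrow> Poly_Mapping.keys g = {0}"
proof -
  obtain N where N: "Poly_Mapping.keys f \<subseteq> range (\<lambda>z::nat. 3 ^ 0 / 4 ^ N * of_nat z)"
    using keys_M34_small_imp_multiples[of f 0] assms(2) eventually_happens'[OF sequentially_bot] by blast
  define F where "F = scaled_poly (1 / 4 ^ N) f"
  have Nf: "1 / 4 ^ N > (0::rat)" "Poly_Mapping.keys f \<subseteq> range (\<lambda>z::nat. 1 / 4 ^ N * of_nat z)"
    using N by simp_all
  have "F \<noteq> 0"
  proof -
    have k: "deg f \<in> Poly_Mapping.keys f" using assms(1) by (rule deg_in_keys)
    then obtain z :: nat where "deg f = 1 / 4 ^ N * of_nat z" using Nf(2) by blast
    then have "coeff F z \<noteq> 0"
      using k unfolding F_def coeff_scaled_poly[OF Nf] by (simp add: in_keys_iff)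
    then show ?thesis by auto
  qed
  define n where "n = degree F"
  have "n < 3 ^ n" by (rule less_exp[THEN less_le_trans]) (simp add: power_mono)
  show thesis
  proof
    fix g h
    assume g: "f = g * h" "Poly_Mapping.keys g \<subseteq> M34" "0 \<in> Poly_Mapping.keys g" "deg g < (3/4) ^ n"
    have "k < (3/4) ^ n" if "k \<in> Poly_Mapping.keys g" for k
      using Max_ge[OF finite_keys that] g(4) by simp
    then have "\<forall>\<^sub>F K in sequentially. Poly_Mapping.keys g \<subseteq> range (\<lambda>z::nat. 3 ^ n / 4 ^ K * of_nat z)"
      using g(2) by (intro keys_M34_small_imp_multiples) auto
    then obtain K where K: "K \<ge> N" "Poly_Mapping.keys g \<subseteq> range (\<lambda>z::nat. 3 ^ n / 4 ^ K * of_nat z)"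
      by (metis (mono_tags, lifting) eventually_sequentially nat_le_linear order_refl)
    define d :: rat where "d = 3 ^ n / 4 ^ K"
    have d: "d > 0" "Poly_Mapping.keys g \<subseteq> range (\<lambda>z::nat. d * of_nat z)"
      using K by (simp_all add: d_def)
    show "Poly_Mapping.keys g = {0}"
    proof (rule ccontr)
      assume "Poly_Mapping.keys g \<noteq> {0}"
      then obtain k where k: "k \<in> Poly_Mapping.keys g" "k \<noteq> 0" using g(3) by blast
      then obtain m where m: "k = d * of_nat m" using d(2) by blast
      define G where "G = scaled_poly d g"
      \<comment> \<open>The exponents \<open>0\<close> and \<open>k\<close> give \<open>G\<close> a
        positive degree and a nonzero constant term, so it has a zero, and that zero is not
        \<open>0\<close>.\<close>
      have Gm: "coeff G m \<noteq> 0" "m > 0" and G0: "coeff G 0 \<noteq> 0"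
        using k m g(3) unfolding G_def coeff_scaled_poly[OF d] by (auto simp: in_keys_iff)
      have "\<exists>z. poly G z = 0"
        using Gm by (intro fundamental_theorem_of_algebra_alt) (auto simp: coeff_pCons split: nat.splits)
      then obtain z where z: "poly G z = 0" by blast
      have "z \<noteq> 0" using z G0 by (auto simp: poly_0_coeff_0)
      \<comment> \<open>Different branches of the logarithm of \<open>z\<close>, divided by
        \<open>d\<close>: all of them are sent to the same zero \<open>z\<close> of
        \<open>G\<close>.\<close>
      define w where "w j = (Ln z + 2 * of_real pi * \<i> * of_nat j) / of_rat d" for j :: nat
      have "poly F (exp (of_rat (1 / 4 ^ N) * w j)) = 0" for j
      proof -
        have "exp (of_rat d * w j) = exp (Ln z) * exp (2 * of_real pi * \<i> * of_nat j)"
          using d(1) by (simp add: w_def exp_add)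
        also have "\<dots> = z"
          using \<open>z \<noteq> 0\<close> exp_integer_2pi[of "of_nat j"] by (simp add: mult_ac)
        finally have "exp_eval (w j) g = 0"
          using z poly_scaled_poly[OF d, of "w j"] by (simp add: G_def)
        then show ?thesis
          unfolding F_def poly_scaled_poly[OF Nf] by (simp add: g(1) exp_eval_mult)
      qed
      then have sub: "(\<lambda>j. exp (of_rat (1 / 4 ^ N) * w j)) ` {..<3 ^ n} \<subseteq> {x. poly F x = 0}"
        by auto
      have "inj_on (\<lambda>j. exp (of_rat (1 / 4 ^ N) * w j)) {..<3 ^ n}"
      proof (rule inj_onI)
        fix i j :: nat
        assume ij: "i \<in> {..<3 ^ n}" "j \<in> {..<3 ^ n}"
          and eq: "exp (of_rat (1 / 4 ^ N) * w i) = exp (of_rat (1 / 4 ^ N) * w j)"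
        \<comment> \<open>In the variable of \<open>F\<close> the points differ by
          \<open>3^n\<close>-th roots of unity with index \<open>j * 4^(K - N)\<close>. As
          \<open>4\<close> is prime to \<open>3\<close>, these are distinct for
          \<open>j < 3^n\<close>.\<close>
        have "(4::complex) ^ K = 4 ^ N * 4 ^ (K - N)"
          using K(1) by (simp flip: power_add)
        then have w: "of_rat (1 / 4 ^ N) * w l = Ln z * 4 ^ (K - N) / 3 ^ n
            + 2 * of_real pi * \<i> * of_nat (l * 4 ^ (K - N)) / of_nat (3 ^ n)" for l
          by (simp add: w_def d_def of_rat_divide of_rat_power field_simps)
        have "(i * 4 ^ (K - N)) mod 3 ^ n = (j * 4 ^ (K - N)) mod 3 ^ n"
          using eq unfolding w exp_add mult_cancel_left
          by (subst (asm) complex_root_unity_eq) simp_all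
        moreover have "coprime 4 (3 :: nat)"
          by (simp add: coprime_iff_gcd_eq_1 gcd_non_0_nat)
        then have "coprime (4 ^ (K - N)) (3 ^ n :: nat)"
          by simp
        ultimately have "i mod 3 ^ n = j mod 3 ^ n"
          by (metis cong_def cong_mult_rcancel_nat)
        then show "i = j" using ij by simp
      qed
      then have "3 ^ n = card ((\<lambda>j. exp (of_rat (1 / 4 ^ N) * w j)) ` {..<3 ^ n})"
        by (simp add: card_image)
      also have "\<dots> \<le> card {x. poly F x = 0}"
        by (intro card_mono sub poly_roots_finite \<open>F \<noteq> 0\<close>)
      also have "\<dots> \<le> n"
        unfolding n_def by (rule card_poly_roots_bound) (fact \<open>F \<noteq> 0\<close>)
      finally show False using \<open>n < 3 ^ n\<close> by simp
    qed
  qed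
qed

section \<open>The monoid algebra\<close>

abbreviation A34 :: "(rat \<Rightarrow>\<^sub>0 rat) set" where
  "A34 \<equiv> nonzero_elems (monoid_algebra M34)"

lemma A34_iff: "p \<in> A34 \<longleftrightarrow> p \<noteq> 0 \<and> Poly_Mapping.keys p \<subseteq> M34"
  by (auto simp: nonzero_elems_def monoid_algebra_def)

lemma single_in_A34: "m \<in> M34 \<Longrightarrow> c \<noteq> 0 \<Longrightarrow> Poly_Mapping.single m c \<in> A34"
  by (auto simp: A34_iff dest: arg_cong[of _ _ Poly_Mapping.keys])

lemma deg_in_M34: "p \<in> A34 \<Longrightarrow> deg p \<in> M34"
  using deg_in_keys by (auto simp: A34_iff)

lemma deg_nonneg: "p \<in> A34 \<Longrightarrow> 0 \<le> deg p"
  by (intro M34_nonneg deg_in_M34)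

lemma deg_mult_A34: "p \<in> A34 \<Longrightarrow> q \<in> A34 \<Longrightarrow> deg (p * q) = deg p + deg q"
  by (intro deg_mult) (auto simp: A34_iff)

lemma A34_mult:
  assumes "p \<in> A34" "q \<in> A34"
  shows "p * q \<in> A34"
proof -
  have "k \<in> M34" if "k \<in> Poly_Mapping.keys (p * q)" for k
  proof -
    obtain a b where "k = a + b" "a \<in> Poly_Mapping.keys p" "b \<in> Poly_Mapping.keys q"
      using subsetD[OF keys_mult \<open>k \<in> Poly_Mapping.keys (p * q)\<close>] by blast
    then show ?thesis using assms by (auto simp: A34_iff intro: M34.add)
  qed
  then show ?thesis using assms by (auto simp: A34_iff)
qed

section \<open>Units, atoms and chains of divisors\<close>

lemma unit_in_A34I:
  assumes "Poly_Mapping.keys p = {0}"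
  shows "unit_in A34 p"
proof -
  define c where "c = Poly_Mapping.lookup p 0"
  have "c \<noteq> 0" using assms by (auto simp: c_def simp flip: in_keys_iff)
  have p: "p = Poly_Mapping.single 0 c"
    using poly_mapping_eq_sum_single[of p] assms by (simp add: c_def)
  have "p * Poly_Mapping.single 0 (1 / c) = 1"
    using \<open>c \<noteq> 0\<close> by (simp add: p mult_single)
  then show ?thesis
    using \<open>c \<noteq> 0\<close> single_in_A34[OF M34.zero] unfolding unit_in_def p by (metis divide_eq_0_iff zero_neq_one)
qed

text \<open>The degrees of a unit and its inverse are nonnegative and add up to
  \<open>0\<close>.\<close>

lemma unit_in_A34_deg:
  assumes "unit_in A34 u"
  shows "deg u = 0"
proof -
  obtain v where v: "u \<in> A34" "v \<in> A34" "u * v = 1"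
    using assms by (auto simp: unit_in_def)
  then have "deg u + deg v = deg (1 :: rat \<Rightarrow>\<^sub>0 rat)"
    by (metis deg_mult_A34)
  then have "deg u + deg v = 0" by simp
  then show ?thesis using deg_nonneg[OF v(1)] deg_nonneg[OF v(2)] by simp
qed

text \<open>In a factorization of a monomial both the largest and the smallest exponents add up to
  its exponent, so both factors are monomials. If neither exponent is \<open>0\<close>, rigidity
  makes both at least \<open>(3/4)^(n+1)\<close>, whose double exceeds
  \<open>(3/4)^n\<close>.\<close>

lemma atom_in_A34:
  "atom_in A34 (Poly_Mapping.single ((3/4) ^ n) 1)"
proof -
  have "unit_in A34 b \<or> unit_in A34 c"
    if b: "b \<in> A34" and c: "c \<in> A34" and eq: "Poly_Mapping.single ((3/4) ^ n) 1 = b * c" for b c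
  proof -
    have nz: "b \<noteq> 0" "c \<noteq> 0" using b c by (auto simp: A34_iff)
    have keys: "Poly_Mapping.keys (b * c) = {(3/4) ^ n}"
      by (simp flip: eq)
    have max: "deg b + deg c = (3/4) ^ n"
      and min: "Min (Poly_Mapping.keys b) + Min (Poly_Mapping.keys c) = (3/4) ^ n"
      using Max_plus_Max_in_keys_mult[OF nz] Min_plus_Min_in_keys_mult[OF nz] unfolding keys by auto
    have le: "Min (Poly_Mapping.keys p) \<le> deg p" if "p \<noteq> 0" for p :: "rat \<Rightarrow>\<^sub>0 rat"
      using that by simp
    have singleton: "Poly_Mapping.keys p = {deg p}"
      if "p \<noteq> 0" "Min (Poly_Mapping.keys p) = deg p" for p :: "rat \<Rightarrow>\<^sub>0 rat"
    proof -
      have "k = deg p" if "k \<in> Poly_Mapping.keys p" for k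
        using Min_le[OF finite_keys that] Max_ge[OF finite_keys that] \<open>Min _ = _\<close> by simp
      then show ?thesis using deg_in_keys[OF \<open>p \<noteq> 0\<close>] by blast
    qed
    have kb: "Poly_Mapping.keys b = {deg b}"
      by (rule singleton[OF nz(1)]) (use max min le[OF nz(1)] le[OF nz(2)] in linarith)
    have kc: "Poly_Mapping.keys c = {deg c}"
      by (rule singleton[OF nz(2)]) (use max min le[OF nz(1)] le[OF nz(2)] in linarith)
    let ?i = "\<lambda>k. if k = n then 1 else 0 :: nat"
    have i: "\<forall>k. ?i k \<le> 2" by simp
    have "deg b = 0 \<or> deg c = 0"
    proof (rule ccontr)
      assume "\<not> ?thesis"
      \<comment> \<open>The generator is rigid as a sum of length \<open>Suc n\<close> with a single
        coefficient \<open>1\<close>.\<close>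
      then have "(3/4) ^ Suc n \<le> deg b" "(3/4) ^ Suc n \<le> deg c"
        using rep_divisor_ge[OF i, of "deg b" "deg c" "Suc n"] rep_divisor_ge[OF i, of "deg c" "deg b" "Suc n"]
          deg_in_M34[OF b] deg_in_M34[OF c] max rep_indicator[OF lessI, of n]
        by (simp_all add: add.commute del: power_Suc)
      then have "2 * (3/4) ^ Suc n \<le> ((3/4) ^ n :: rat)" using max by linarith
      then show False by simp
    qed
    then show ?thesis using kb kc unit_in_A34I by metis
  qed
  moreover have "\<not> unit_in A34 (Poly_Mapping.single ((3/4) ^ n) 1)"
    using unit_in_A34_deg by fastforce
  ultimately show ?thesis
    unfolding atom_in_def using single_in_A34[OF M34.gen] by simp
qed

lemma atomic_in_A34_single:
  assumes "m \<in> M34"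
  shows "atomic_in A34 (Poly_Mapping.single m 1)"
proof -
  have "\<exists>xs. (\<forall>x\<in>set xs. atom_in A34 x) \<and> Poly_Mapping.single m 1 = prod_list xs"
    using assms
  proof (induction rule: M34.induct)
    case zero
    \<comment> \<open>The empty product is \<open>1\<close>, which \<open>atomic_in\<close> admits
      as a unit.\<close>
    show ?case by (intro exI[of _ "[]"]) simp
  next
    case (gen n)
    show ?case by (rule exI[of _ "[Poly_Mapping.single ((3/4) ^ n) 1]"]) (simp add: atom_in_A34)
  next
    case (add a b)
    then obtain xs ys where atoms: "\<forall>x\<in>set xs. atom_in A34 x" "\<forall>x\<in>set ys. atom_in A34 x"
      and prods: "Poly_Mapping.single a 1 = prod_list xs" "Poly_Mapping.single b 1 = prod_list ys"
      by blast
    have "Poly_Mapping.single (a + b) 1 = prod_list (xs @ ys)"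
      by (simp add: mult_single flip: prods)
    with atoms show ?case
      by (intro exI[of _ "xs @ ys"]) auto
  qed
  moreover have "unit_in A34 1" by (rule unit_in_A34I) simp
  ultimately show ?thesis
    unfolding atomic_in_def using single_in_A34[OF assms] by (metis prod_list.Nil zero_neq_one)
qed

text \<open>Every quotient of consecutive terms divides \<open>f\<close>, so each proper step lowers
  the degree by at least \<open>\<epsilon>\<close>. Degrees are nonnegative, which leaves only
  finitely many such steps.\<close>

lemma accp_elem_A34I:
  assumes "f \<in> A34" "\<epsilon> > 0"
    and div: "\<And>g h. \<lbrakk>g \<in> A34; h \<in> A34; f = g * h; \<not> unit_in A34 g\<rbrakk> \<Longrightarrow> \<epsilon> \<le> deg g"
  shows "accp_elem A34 f"
  unfolding accp_elem_def
proof (intro conjI allI impI assms(1))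
  fix F :: "nat \<Rightarrow> rat \<Rightarrow>\<^sub>0 rat"
  assume F0: "F 0 = f" and F: "\<forall>n. F n \<in> A34 \<and> dvd_in A34 (F (Suc n)) (F n)"
  then obtain q where q: "\<And>n. q n \<in> A34" "\<And>n. F n = F (Suc n) * q n"
    unfolding dvd_in_def by metis
  have Fdvd: "\<exists>h\<in>A34. f = F n * h" for n
  proof (induction n)
    case 0
    show ?case using F0 single_in_A34[OF M34.zero, of 1] by (metis mult.right_neutral single_one zero_neq_one)
  next
    case (Suc n)
    then show ?case using q by (metis A34_mult mult.assoc)
  qed
  \<comment> \<open>This natural number never grows along the chain and drops at each proper step;
    from an index where it is minimal it is constant.\<close>
  define v where "v n = nat \<lfloor>deg (F n) / \<epsilon>\<rfloor>" for n
  obtain N where N: "\<And>n. v N \<le> v n"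
    using ex_has_least_nat[of "\<lambda>_. True" _ v] by blast
  have deg_F: "deg (F n) = deg (F (Suc n)) + deg (q n)" for n
    using q F deg_mult_A34 by metis
  have v_le: "v (Suc n) \<le> v n" for n
    unfolding v_def deg_F[of n] using assms(2) deg_nonneg[OF q(1)[of n]]
    by (intro nat_mono floor_mono divide_right_mono) auto
  have v_eq: "v n = v N" if "n \<ge> N" for n
    using lift_Suc_antimono_le[of v, OF v_le that] N[of n] by simp
  have "dvd_in A34 (F n) (F (Suc n))" if "n \<ge> N" for n
  proof (cases "unit_in A34 (q n)")
    case True
    then obtain u where u: "u \<in> A34" "q n * u = 1" by (auto simp: unit_in_def)
    then have "F (Suc n) = F n * u" using q(2)[of n] by (simp add: mult.assoc)
    then show ?thesis using u by (auto simp: dvd_in_def)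
  next
    case False
    obtain h where "h \<in> A34" "f = F n * h" using Fdvd by blast
    then have "f = q n * (F (Suc n) * h)" using q(2)[of n] by (simp add: mult_ac)
    then have "\<epsilon> \<le> deg (q n)"
      using False F \<open>h \<in> A34\<close> div[OF q(1) A34_mult] by blast
    then have "deg (F (Suc n)) / \<epsilon> + 1 \<le> deg (F n) / \<epsilon>"
      using assms(2) deg_F[of n] by (simp add: field_simps)
    moreover have "0 \<le> deg (F (Suc n)) / \<epsilon>"
      using deg_nonneg F assms(2) by simp
    ultimately have "v (Suc n) < v n"
      unfolding v_def by linarith
    then show ?thesis using v_eq[of n] v_eq[of "Suc n"] that by simp
  qed
  then show "\<exists>N. \<forall>n\<ge>N. dvd_in A34 (F n) (F (Suc n))" by blast
qed

text \<open>The exponent \<open>t\<close> of \<open>f\<close> splits into exponents \<open>a\<close>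
  of \<open>g\<close> and \<open>b\<close> of \<open>h\<close>. If \<open>a = 0\<close>, then
  \<open>g\<close> has a constant term and the zero count bounds its degree; otherwise
  \<open>a\<close> divides a rigid sum and is at least \<open>(3/4)^N\<close>.\<close>

lemma accp_elem_A34_of_key:
  assumes f: "f \<in> A34" and t: "t \<in> Poly_Mapping.keys f" "t = rep N c" and c: "\<forall>n. c n \<le> 2"
  shows "accp_elem A34 f"
proof -
  obtain n where n: "\<And>g h. \<lbrakk>f = g * h; Poly_Mapping.keys g \<subseteq> M34; 0 \<in> Poly_Mapping.keys g; deg g < (3/4) ^ n\<rbrakk>
     \<Longrightarrow> Poly_Mapping.keys g = {0}"
    using small_divisor_constant f unfolding A34_iff by metis
  show ?thesis
  proof (rule accp_elem_A34I[OF f, of "min ((3/4) ^ n) ((3/4) ^ N)"])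
    fix g h assume gh: "g \<in> A34" "h \<in> A34" "f = g * h" "\<not> unit_in A34 g"
    obtain a b where ab: "t = a + b" "a \<in> Poly_Mapping.keys g" "b \<in> Poly_Mapping.keys h"
      using t(1) keys_mult[of g h] gh(3) by blast
    show "min ((3/4) ^ n) ((3/4) ^ N) \<le> deg g"
    proof (cases "a = 0")
      case True
      then have "\<not> deg g < (3/4) ^ n"
        using n[OF gh(3)] unit_in_A34I ab(2) gh(1,4) by (auto simp: A34_iff)
      then show ?thesis by simp
    next
      case False
      then have "(3/4) ^ N \<le> a"
        using rep_divisor_ge[OF c, of a b N] ab t(2) gh(1,2) by (auto simp: A34_iff)
      also have "a \<le> deg g" using ab(2) by simp
      finally show ?thesis by simp
    qed
  qed simp
qed

text \<open>Since \<open>3 * (3/4)^n = 4 * (3/4)^(n+1)\<close>, each \<open>f n\<close> is the next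
  one times the atom with exponent \<open>(3/4)^(n+1)\<close>, while the degrees strictly
  fall.\<close>

lemma not_accp_A34: "\<not> accp A34"
proof
  assume "accp A34"
  define f :: "nat \<Rightarrow> rat \<Rightarrow>\<^sub>0 rat" where "f n = Poly_Mapping.single (3 * (3/4) ^ n) 1" for n
  have f: "f n \<in> A34" for n
    unfolding f_def using M34_of_nat_mult[OF M34.gen, of 3 n] by (intro single_in_A34) auto
  have "dvd_in A34 (f (Suc n)) (f n)" for n
    unfolding dvd_in_def
    by (rule bexI[of _ "Poly_Mapping.single ((3/4) ^ Suc n) 1"])
      (simp_all add: f_def mult_single single_in_A34 M34.gen del: power_Suc, simp)
  with \<open>accp A34\<close> f obtain N where "dvd_in A34 (f N) (f (Suc N))"
    unfolding accp_def accp_elem_def by blast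
  then obtain c where "c \<in> A34" "f (Suc N) = f N * c" by (auto simp: dvd_in_def)
  then have "deg (f N) \<le> deg (f (Suc N))"
    using deg_mult_A34 f deg_nonneg by (metis le_add_same_cancel1)
  then show False by (simp add: f_def)
qed

text \<open>The common divisor is taken of all exponents of all elements of \<open>S\<close> at
  once. The monomial with exponent \<open>d\<close> then divides every element, and one having
  \<open>t\<close> as an exponent is left with a rigid exponent.\<close>

lemma almost_accp_A34: "almost_accp A34"
  unfolding almost_accp_def
proof (intro allI impI, elim conjE)
  fix S :: "(rat \<Rightarrow>\<^sub>0 rat) set"
  assume S: "finite S" "S \<noteq> {}" "S \<subseteq> A34"
  have T: "finite (\<Union>(Poly_Mapping.keys ` S))" "\<Union>(Poly_Mapping.keys ` S) \<noteq> {}"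
    "\<Union>(Poly_Mapping.keys ` S) \<subseteq> M34"
    using S by (auto simp: A34_iff subset_eq)
  obtain d t N c where d: "d \<in> M34" "\<And>s. s \<in> \<Union>(Poly_Mapping.keys ` S) \<Longrightarrow> s - d \<in> M34"
    and t: "t \<in> \<Union>(Poly_Mapping.keys ` S)" "\<forall>n. c n \<le> 2" "t - d = rep N c"
    using finite_common_divisor[OF T] by metis
  let ?d = "Poly_Mapping.single d 1 :: rat \<Rightarrow>\<^sub>0 rat"
  \<comment> \<open>Division by the monomial is done in the ring with all rational exponents, where
    it is invertible; the choice of \<open>d\<close> puts the quotient back into
    \<open>A34\<close>.\<close>
  define q where "q s = Poly_Mapping.single (- d) 1 * s" for s :: "rat \<Rightarrow>\<^sub>0 rat"
  have q: "s = ?d * q s" for s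
    by (simp add: q_def mult_single flip: mult.assoc)
  have keys_q: "Poly_Mapping.keys (q s) = (\<lambda>k. k - d) ` Poly_Mapping.keys s" for s
  proof -
    have "Poly_Mapping.keys (q s) \<subseteq> (\<lambda>k. k - d) ` Poly_Mapping.keys s"
      using keys_mult[of "Poly_Mapping.single (- d) 1" s] unfolding q_def by auto
    \<comment> \<open>Multiplying back shows that no exponent is lost, which keeps
      \<open>t - d\<close> among the exponents of the quotient.\<close>
    moreover have "k - d \<in> Poly_Mapping.keys (q s)" if "k \<in> Poly_Mapping.keys s" for k
    proof -
      have "k \<in> Poly_Mapping.keys (?d * q s)" using that q by metis
      then show ?thesis using subsetD[OF keys_mult] by fastforce
    qed
    ultimately show ?thesis by blast
  qed
  have q_in: "q s \<in> A34" if "s \<in> S" for s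
  proof -
    have "q s \<noteq> 0"
      using that S(3) q[of s] by (metis A34_iff mult_zero_right subsetD)
    moreover have "Poly_Mapping.keys (q s) \<subseteq> M34"
      unfolding keys_q using that d(2) by blast
    ultimately show ?thesis by (simp add: A34_iff)
  qed
  have dvd: "\<forall>s\<in>S. dvd_in A34 ?d s"
    using q q_in unfolding dvd_in_def by blast
  obtain s where s: "s \<in> S" "t \<in> Poly_Mapping.keys s" using t(1) by blast
  have accp: "accp_elem A34 (q s)"
    by (rule accp_elem_A34_of_key[OF q_in[OF s(1)] _ t(3) t(2)]) (use s keys_q in auto)
  show "\<exists>d. atomic_in A34 d \<and> (\<forall>s\<in>S. dvd_in A34 d s) \<and>
          (\<exists>s\<in>S. \<exists>q\<in>A34. s = d * q \<and> accp_elem A34 q)"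
    using atomic_in_A34_single[OF d(1)] dvd s(1) q_in[OF s(1)] q[of s] accp by (intro exI conjI bexI)
qed

theorem theorem4p9:
  shows "almost_accp (nonzero_elems (monoid_algebra M34 :: (rat \<Rightarrow>\<^sub>0 rat) set))
       \<and> \<not> accp (nonzero_elems (monoid_algebra M34 :: (rat \<Rightarrow>\<^sub>0 rat) set))"
  using almost_accp_A34 not_accp_A34 by blast

end
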